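(* There exists an absolute constant $c>0$ such that the following holds. Let $r\ge 3$ and $s\geq 1$ be integers and let $A\subset \mathbb{Z}^2$ be a finite set. Suppose that $A$ consists of at least $r$ rows of size at least $s$; that is, for some fixed coordinate direction $j\in\{1,2\}$, $A$ has at least $r$ non-empty rows in direction $j$, and every non-empty row of $A$ in direction $j$ has at least $s$ elements. Then $$\|F_A\|_1 \geq c\, \log s \left(\frac{\log r}{\log\log r}\right)^{1/2}.$$
   Context: For a finite set $A\subset\mathbb{Z}^d$, the exponential sum of $A$ is $F_A(x)=\sum_{a\in A} e(a\cdot x)$ for $x\in\mathbb{T}^d=(\mathbb{R}/\mathbb{Z})^d$, where $e(t)=\exp(2\pi i t)$ and $\cdot$ is the usual dot product. Its $L^1$-norm is $\|F_A\|_1=\int_{\mathbb{T}^d}|F_A(x)|\,dx$, with respect to the Haar probability measure on $\mathbb{T}^d$. For $A\subseteq\mathbb{Z}^2$ and $j\in\{1,2\}$, a row of $A$ in direction $j$ is the intersection of $A$ with a line $\{(x_1,x_2)\in\mathbb{Z}^2 : x_i=a\}$, where $i\in\{1,2\}\setminus\{j\}$ and $a\in\mathbb{Z}$. The logarithm is the natural logarithm. *)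

theory Defs
  imports "HOL-Analysis.Analysis"
begin

definition e :: "real \<Rightarrow> complex" where
  "e t = exp (2 * of_real pi * \<i> * of_real t)"

definition exp_sum :: "(int ^ 'd) set \<Rightarrow> real ^ 'd \<Rightarrow> complex" where
  "exp_sum A x = (\<Sum>a\<in>A. e (\<Sum>i\<in>UNIV. of_int (a $ i) * x $ i))"

text \<open>
  Functions on the torus are represented by functions on the Euclidean space that are
  periodic under integer translations; the Haar probability measure is then Lebesgue measure
  on the unit cube. The lemmas below record that this makes sense.
\<close>

definition unit_cube :: "(real ^ 'd) set" where
  "unit_cube = {x. \<forall>i. 0 \<le> x $ i \<and> x $ i \<le> 1}"

definition torus_L1_norm :: "(real ^ 'd \<Rightarrow> complex) \<Rightarrow> real" where
  "torus_L1_norm f = (LINT x:unit_cube|lborel. norm (f x))"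

text \<open>
  The rows of \<open>A\<close> in direction \<open>j\<close>: here \<open>i\<close> ranges over the
  one index of type \<open>2\<close> other than \<open>j\<close>. Rows may be empty.
\<close>

definition rows_in_direction :: "2 \<Rightarrow> (int ^ 2) set \<Rightarrow> (int ^ 2) set set" where
  "rows_in_direction j A = {A \<inter> {x. x $ i = a} | i a. i \<noteq> j}"

definition consists_of_rows :: "nat \<Rightarrow> nat \<Rightarrow> (int ^ 2) set \<Rightarrow> bool" where
  "consists_of_rows r s A \<longleftrightarrow>
     (\<exists>j. card {R \<in> rows_in_direction j A. R \<noteq> {}} \<ge> r \<and>
          (\<forall>R \<in> rows_in_direction j A. R \<noteq> {} \<longrightarrow> card R \<ge> s))"

lemma unit_cube_eq_cbox: "unit_cube = cbox 0 (\<chi> i. 1)"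
  by (auto simp: unit_cube_def mem_box_cart)

lemma measure_unit_cube: "measure lborel (unit_cube :: (real ^ 'd) set) = 1"
  unfolding unit_cube_eq_cbox
  by (subst measure_lborel_cbox) (auto simp: Basis_vec_def inner_axis intro!: prod.neutral)

lemma e_add_int: "e (t + of_int n) = e t"
proof -
  have "exp (2 * of_int n * of_real pi * \<i>) = (1 :: complex)"
    using exp_integer_2pi[of "of_int n"] by (simp add: mult_ac)
  then show ?thesis
    by (simp add: e_def distrib_left exp_add mult_ac)
qed

lemma exp_sum_periodic: "exp_sum A (x + (\<chi> i. of_int (n $ i))) = exp_sum A x"
proof -
  have "(\<Sum>i\<in>UNIV. of_int (a $ i) * (x + (\<chi> i. of_int (n $ i))) $ i) =
        (\<Sum>i\<in>UNIV. of_int (a $ i) * x $ i) + of_int (\<Sum>i\<in>UNIV. a $ i * n $ i)" for a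
    by (simp add: distrib_left sum.distrib)
  then show ?thesis
    unfolding exp_sum_def by (simp only: e_add_int)
qed

lemma set_integrable_norm_exp_sum:
  "set_integrable lborel unit_cube (\<lambda>x. norm (exp_sum A x))"
  unfolding unit_cube_eq_cbox exp_sum_def e_def set_integrable_def
  by (rule borel_integrable_compact) (auto intro!: continuous_intros)

end

(*
The McGehee-Pigno-Smith inequality bounds the L^1 norm of a trigonometric sum with arbitrary
coefficients c_1, ..., c_N from below by a constant times the sum of |c_k| / k. Write F_A(x, y) as
the sum over the rows k of p_k(x) e(k y), where p_k is the exponential sum of the row. For fixed x
the inequality in y bounds the inner integral below by the sum of |p_k(x)| / rank(k); integrating
over x and applying the inequality again to each p_k gives ||F_A||_1 >= c^2 log r log s, which is
stronger than the claim.

The inequality itself is proved by duality. The test function is the sum over j of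
f_j exp(- eps (h_{j+1} + h_{j+2} + ...)), where f_j is the normalised sum of the conjugate phases
over the j-th block, of about 4^j indices. Conjugate functions are avoided: Re h_j >= |f_j| is
arranged with h_j a polynomial in e(t), by Stone-Weierstrass on the circle, and the Fourier coefficients that have to vanish do so by
Cauchy's theorem.
*)

theory Submission
  imports Defs "HOL-Complex_Analysis.Complex_Analysis"
begin

section \<open>Exponentials and mean values on the circle\<close>

lemma norm_e [simp]: "norm (e t) = 1"
  by (simp add: e_def)

lemma e_add: "e (s + t) = e s * e t"
  by (simp add: e_def distrib_left exp_add)

lemma e_int_diff: "e (of_int (m - n) * t) = e (of_int m * t) * e (of_int (- n) * t)"
  by (simp add: left_diff_distrib flip: e_add)

lemma cnj_e: "cnj (e t) = e (- t)"
  by (simp add: e_def exp_cnj)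

lemma e_nonzero [simp]: "e t \<noteq> 0"
  by (simp add: e_def)

lemma e_of_nat_mult: "e (of_nat n * t) = e t ^ n"
  by (simp add: e_def exp_of_nat_mult [symmetric] mult_ac)

lemma e_of_int_mult: "e (of_int n * t) = e t powi n"
  by (simp add: e_def exp_power_int mult_ac)

lemma continuous_on_e [continuous_intros]:
  "continuous_on S f \<Longrightarrow> continuous_on S (\<lambda>x. e (f x))"
  unfolding e_def by (intro continuous_intros)

text \<open>Cauchy's formula at the centre of the unit disc: along \<open>circlepath 0 1\<close> the
  factor 1/z cancels against the derivative of the path up to 2 pi i. A factor vanishing at 0
  therefore forces the mean to vanish.\<close>

lemma has_integral_entire_e:
  assumes "g holomorphic_on UNIV"
  shows "((\<lambda>t. g (e t)) has_integral g 0) {0..1}"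
proof -
  have "((\<lambda>u. g u / (u - 0)) has_contour_integral (2 * of_real pi * \<i> * g 0)) (circlepath 0 1)"
    by (rule Cauchy_integral_circlepath_simple) (use assms in \<open>auto intro: holomorphic_on_subset\<close>)
  then have "((\<lambda>t. (g (e t) / e t) * (2 * pi * \<i> * e t)) has_integral (2 * of_real pi * \<i> * g 0)) {0..1}"
    unfolding has_contour_integral
  proof (rule has_integral_eq [rotated])
    fix x :: real
    have "circlepath 0 1 x = e x" by (simp add: circlepath e_def)
    moreover have "vector_derivative (circlepath 0 1) (at x) = 2 * pi * \<i> * e x"
      by (simp add: vector_derivative_circlepath e_def)
    ultimately show "g (circlepath 0 1 x) / (circlepath 0 1 x - 0) *
        vector_derivative (circlepath 0 1) (at x) = g (e x) / e x * (2 * pi * \<i> * e x)"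
      by simp
  qed
  then have "((\<lambda>t. (g (e t) / e t) * (2 * pi * \<i> * e t) / (2 * of_real pi * \<i>)) has_integral
      (2 * of_real pi * \<i> * g 0) / (2 * of_real pi * \<i>)) {0..1}"
    by (rule has_integral_divide)
  then show ?thesis by simp
qed

lemma has_integral_e_int:
  "((\<lambda>t. e (of_int n * t)) has_integral (if n = 0 then 1 else 0)) {0..1}"
proof -
  have pos: "((\<lambda>t. e (of_nat n * t)) has_integral 0) {0..1}" if "n > 0" for n :: nat
    using has_integral_entire_e [of "\<lambda>z. z ^ n"] that
    by (simp add: e_of_nat_mult holomorphic_intros zero_power)
  consider "n = 0" | "n > 0" | "n < 0" by linarith
  then show ?thesis
  proof cases
    case 1
    then show ?thesis using has_integral_const_real [of "1::complex" 0 1] by (simp add: e_def)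
  next
    case 2
    then show ?thesis using pos [of "nat n"] by simp
  next
    case 3
    have "(cnj \<circ> (\<lambda>t. e (of_nat (nat (- n)) * t)) has_integral cnj 0) {0..1}"
      using pos [of "nat (- n)"] 3 by (subst has_integral_cnj) simp
    then show ?thesis using 3 by (simp add: o_def cnj_e)
  qed
qed

text \<open>Orthogonality leaves only the diagonal of the expanded square, because distinct indices
  have distinct frequencies.\<close>

lemma integral_norm_exp_poly_squared:
  assumes "finite B" "inj_on m B"
  shows "((\<lambda>t. (norm (\<Sum>k\<in>B. u k * e (of_int (m k) * t)))\<^sup>2) has_integral (\<Sum>k\<in>B. (norm (u k))\<^sup>2)) {0..1}"
proof -
  have "((\<lambda>t. \<Sum>k\<in>B. \<Sum>l\<in>B. u k * cnj (u l) * e (of_int (m k - m l) * t)) has_integral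
       (\<Sum>k\<in>B. \<Sum>l\<in>B. u k * cnj (u l) * (if m k - m l = 0 then 1 else 0))) {0..1}"
    by (intro has_integral_sum has_integral_mult_right has_integral_e_int assms)
  also have "(\<lambda>t. \<Sum>k\<in>B. \<Sum>l\<in>B. u k * cnj (u l) * e (of_int (m k - m l) * t)) =
      (\<lambda>t. of_real ((norm (\<Sum>k\<in>B. u k * e (of_int (m k) * t)))\<^sup>2))"
    by (rule ext, subst complex_norm_square)
      (simp add: sum_product cnj_e mult_ac algebra_simps flip: e_add)
  also have "(\<Sum>k\<in>B. \<Sum>l\<in>B. u k * cnj (u l) * (if m k - m l = 0 then 1 else 0)) =
      (\<Sum>k\<in>B. \<Sum>l\<in>B. if l = k then u k * cnj (u l) else 0)"
    using assms by (intro sum.cong) (auto dest: inj_onD)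
  also have "\<dots> = of_real (\<Sum>k\<in>B. (norm (u k))\<^sup>2)"
    using assms by (simp add: sum.delta flip: complex_norm_square)
  finally show ?thesis
    by (auto dest: has_integral_Re simp: o_def)
qed

section \<open>Analytic majorants on the unit circle\<close>

text \<open>On the circle \<open>cnj z\<close> is the inverse of z, so the product is a Laurent
  polynomial, and conjugating its negative powers leaves the real part unchanged. The induction
  splits off both constant coefficients; \<open>z * cnj z = 1\<close> then removes one power of z
  from each factor.\<close>

lemma ex_poly_Re_mult_cnj:
  "\<exists>r. \<forall>z. norm z = 1 \<longrightarrow> Re (poly p z * cnj (poly q z)) = Re (poly r z)"
proof (induction p arbitrary: q)
  case 0
  then show ?case by (auto intro: exI [of _ 0])
next
  case (pCons a p)
  obtain b q' where q: "q = pCons b q'" by (cases q)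
  obtain r where r: "\<And>z. norm z = 1 \<Longrightarrow> Re (poly p z * cnj (poly q' z)) = Re (poly r z)"
    using pCons by blast
  have "Re (poly (pCons a p) z * cnj (poly q z)) =
      Re (poly (smult (cnj a) q + smult (cnj b) (pCons 0 p) + r) z)" if "norm z = 1" for z
  proof -
    have zz: "z * cnj z = 1" using that by (simp add: complex_norm_square [symmetric])
    have "poly (pCons a p) z * cnj (poly q z) = a * cnj (poly q z) + z * poly p z * cnj b
        + (z * cnj z) * (poly p z * cnj (poly q' z))"
      by (simp add: q algebra_simps)
    moreover have "Re (a * cnj (poly q z)) = Re (cnj a * poly q z)" by simp
    ultimately show ?thesis using r [OF that] by (simp add: zz algebra_simps)
  qed
  then show ?case by blast
qed

text \<open>Since Re a Re b is the mean of Re (ab) and Re (a \<open>cnj b\<close>), real parts of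
  polynomials form an algebra on the circle, as Stone-Weierstrass requires.\<close>

lemma ex_poly_Re_mult:
  "\<exists>r. \<forall>z. norm z = 1 \<longrightarrow> Re (poly p z) * Re (poly q z) = Re (poly r z)"
proof -
  obtain r where r: "\<And>z. norm z = 1 \<Longrightarrow> Re (poly p z * cnj (poly q z)) = Re (poly r z)"
    using ex_poly_Re_mult_cnj by blast
  have "Re (poly p z) * Re (poly q z) = Re (poly (smult (1/2) (p * q + r)) z)" if "norm z = 1" for z
    using r [OF that] by (simp add: Re_divide)
  then show ?thesis by blast
qed

lemma Re_poly_dense_on_circle:
  assumes "continuous_on (sphere 0 1) \<phi>" "\<delta> > 0"
  shows "\<exists>p. \<forall>z. norm z = 1 \<longrightarrow> \<bar>\<phi> z - Re (poly p z)\<bar> < \<delta>"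
proof -
  define P where "P f \<longleftrightarrow> (\<exists>p. \<forall>z. norm z = 1 \<longrightarrow> f z = Re (poly p z))" for f
  have "\<exists>g. P g \<and> (\<forall>z\<in>sphere 0 1. \<bar>\<phi> z - g z\<bar> < \<delta>)"
  proof (rule Stone_Weierstrass_HOL)
    show "P (\<lambda>x. c)" for c unfolding P_def by (rule exI [of _ "[:of_real c:]"]) simp
  next
    fix f assume "P f"
    then obtain p where p: "\<And>z. norm z = 1 \<Longrightarrow> f z = Re (poly p z)" by (auto simp: P_def)
    have "continuous_on (sphere 0 1) (\<lambda>z. Re (poly p z))" by (intro continuous_intros)
    then show "continuous_on (sphere 0 1) f"
      by (rule continuous_on_eq) (simp add: p)
  next
    fix f g assume "P f \<and> P g"
    then obtain p q where "\<And>z. norm z = 1 \<Longrightarrow> f z = Re (poly p z)"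
      "\<And>z. norm z = 1 \<Longrightarrow> g z = Re (poly q z)" by (auto simp: P_def)
    then show "P (\<lambda>x. f x + g x)" "P (\<lambda>x. f x * g x)"
      using ex_poly_Re_mult [of p q] by (auto simp: P_def intro!: exI [of _ "p + q"])
  next
    fix x y :: complex assume "x \<in> sphere 0 1 \<and> y \<in> sphere 0 1 \<and> x \<noteq> y"
    moreover have "P Re" unfolding P_def by (rule exI [of _ "[:0, 1:]"]) simp
    \<comment> \<open>Im z = Re (-i z); together with \<open>Re\<close> this separates
      points.\<close>
    moreover have "P Im" unfolding P_def by (rule exI [of _ "[:0, - \<i>:]"]) simp
    ultimately show "\<exists>f. P f \<and> f x \<noteq> f y" by (metis complex_eqI)
  qed (use assms in auto)
  then show ?thesis unfolding P_def by force
qed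

text \<open>Normalising \<open>Im (p 0) = 0\<close> makes the mean value \<open>(p 0)\<^sup>2\<close> of \<open>p\<^sup>2\<close> nonnegative, which bounds the
  conjugate function \<open>Im p\<close> by \<open>Re p\<close> in \<open>L\<^sup>2\<close>.\<close>

lemma ex_poly_analytic_majorant:
  assumes "continuous_on (sphere 0 1) \<phi>" "\<delta> > 0" "\<And>z. norm z = 1 \<Longrightarrow> \<phi> z \<ge> 0"
  obtains p where "\<And>z. norm z = 1 \<Longrightarrow> \<phi> z \<le> Re (poly p z)"
    "integral {0..1} (\<lambda>t. (norm (poly p (e t)))\<^sup>2) \<le> 2 * integral {0..1} (\<lambda>t. (\<phi> (e t) + \<delta>)\<^sup>2)"
proof -
  \<comment> \<open>Approximating the shifted function within \<delta>/2 traps Re q between \<phi>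
    and \<phi> + \<delta>, so it is a majorant and not only an approximation.\<close>
  have "continuous_on (sphere 0 1) (\<lambda>z. \<phi> z + \<delta> / 2)" by (intro continuous_intros assms)
  then obtain q where q: "\<And>z. norm z = 1 \<Longrightarrow> \<bar>\<phi> z + \<delta> / 2 - Re (poly q z)\<bar> < \<delta> / 2"
    using Re_poly_dense_on_circle [of _ "\<delta> / 2"] assms(2) by (meson half_gt_zero)
  define p where "p = q - [:\<i> * Im (poly q 0):]"
  have Re_p: "Re (poly p z) = Re (poly q z)" for z by (simp add: p_def)
  have Im_p: "Im (poly p 0) = 0" by (simp add: p_def)
  have le: "\<phi> z \<le> Re (poly p z)" "Re (poly p z) \<le> \<phi> z + \<delta>" if "norm z = 1" for z
    using q [OF that] unfolding Re_p abs_less_iff by linarith+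
  have cont: "continuous_on {0..1} (\<lambda>t. \<phi> (e t))"
    by (rule continuous_on_compose2 [OF assms(1)]) (auto intro!: continuous_intros)
  have "((\<lambda>t. (poly p (e t))\<^sup>2) has_integral (poly p 0)\<^sup>2) {0..1}"
    by (rule has_integral_entire_e) (intro holomorphic_intros)
  then have "((\<lambda>t. Re ((poly p (e t))\<^sup>2)) has_integral Re ((poly p 0)\<^sup>2)) {0..1}"
    by (auto dest: has_integral_Re simp: o_def)
  \<comment> \<open>This integrand is the squared modulus, by \<open>norm_sq\<close> below; the mean
    of the subtracted term is known from the value at 0.\<close>
  then have I: "((\<lambda>t. 2 * (Re (poly p (e t)))\<^sup>2 - Re ((poly p (e t))\<^sup>2)) has_integral
      2 * integral {0..1} (\<lambda>t. (Re (poly p (e t)))\<^sup>2) - Re ((poly p 0)\<^sup>2)) {0..1}"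
    by (intro has_integral_diff has_integral_mult_right integrable_integral integrable_continuous_real
        continuous_intros)
  have norm_sq: "2 * (Re w)\<^sup>2 - Re (w\<^sup>2) = (norm w)\<^sup>2" for w
    by (simp add: cmod_power2 Re_power2)
  have "integral {0..1} (\<lambda>t. (norm (poly p (e t)))\<^sup>2) =
      2 * integral {0..1} (\<lambda>t. (Re (poly p (e t)))\<^sup>2) - Re ((poly p 0)\<^sup>2)"
    using integral_unique [OF I] unfolding norm_sq by simp
  also have "\<dots> \<le> 2 * integral {0..1} (\<lambda>t. (Re (poly p (e t)))\<^sup>2)"
    using Im_p by (simp add: power2_eq_square)
  also have "\<dots> \<le> 2 * integral {0..1} (\<lambda>t. (\<phi> (e t) + \<delta>)\<^sup>2)"
    using le assms(3) order_trans [OF assms(3) le(1)]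
    by (intro mult_left_mono integral_le integrable_continuous_real continuous_intros cont)
      (auto intro!: power_mono)
  finally show ?thesis using that le by blast
qed

section \<open>Estimates for the test function\<close>

text \<open>The right half-plane is convex, contains 0 and z, and the derivative of exp (-w) has
  modulus at most 1 there.\<close>

lemma norm_exp_minus_one_le:
  assumes "Re z \<ge> 0"
  shows "norm (exp (- z) - 1) \<le> norm z"
proof -
  have "norm (exp (- z) - exp (- 0)) \<le> 1 * norm (z - 0)"
  proof (rule field_differentiable_bound [where S = "{w. Re w \<ge> 0}" and f' = "\<lambda>w. - exp (- w)"])
    show "((\<lambda>w. exp (- w)) has_field_derivative - exp (- w)) (at w within {w. Re w \<ge> 0})" for w :: complex
      by (auto intro!: derivative_eq_intros)
  qed (use assms in \<open>auto simp: convex_halfspace_Re_ge\<close>)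
  then show ?thesis by simp
qed

text \<open>Passing to \<open>Suc m\<close> multiplies the old sum by
  \<open>exp (- \<epsilon> h)\<close> and adds the new f. With x the modulus of the new f, the
  factor is at most 1 - \<epsilon> x/2 in modulus, so a bound of 2/\<epsilon> drops by exactly the x
  that the new term can add back. Hence the bound does not grow with m.\<close>

lemma norm_exp_recursion_le:
  fixes f h :: "nat \<Rightarrow> complex"
  assumes "0 < \<epsilon>" "\<epsilon> \<le> 1" "\<And>j. norm (f j) \<le> 1" "\<And>j. norm (f j) \<le> Re (h j)"
  shows "norm (\<Sum>j\<le>m. f j * exp (- of_real \<epsilon> * (\<Sum>l\<in>{j<..m}. h l))) \<le> 2 / \<epsilon>"
proof (induction m)
  case 0
  have "norm (f 0) \<le> 1" by (rule assms)
  also have "\<dots> \<le> 2 / \<epsilon>" using assms(1,2) by (simp add: field_simps)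
  finally show ?case by simp
next
  case (Suc m)
  define F where "F = (\<Sum>j\<le>m. f j * exp (- of_real \<epsilon> * (\<Sum>l\<in>{j<..m}. h l)))"
  have split: "{j<..Suc m} = insert (Suc m) {j<..m}" if "j \<le> m" for j using that by auto
  have "(\<Sum>j\<le>m. f j * exp (- of_real \<epsilon> * (\<Sum>l\<in>{j<..Suc m}. h l))) = F * exp (- of_real \<epsilon> * h (Suc m))"
    unfolding F_def sum_distrib_right
    by (intro sum.cong) (simp_all add: split algebra_simps exp_add exp_diff exp_minus field_simps)
  then have eq: "(\<Sum>j\<le>Suc m. f j * exp (- of_real \<epsilon> * (\<Sum>l\<in>{j<..Suc m}. h l))) =
      F * exp (- of_real \<epsilon> * h (Suc m)) + f (Suc m)"
    by simp
  define x where "x = norm (f (Suc m))"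
  have x: "0 \<le> x" "x \<le> 1" "x \<le> Re (h (Suc m))" using assms by (simp_all add: x_def)
  have "exp (- (\<epsilon> * x)) \<le> 1 - \<epsilon> * x / 2"
  proof -
    have y: "0 \<le> \<epsilon> * x" "\<epsilon> * x \<le> 1" using x assms(1,2) by (auto simp: mult_le_one)
    have "1 + \<epsilon> * x \<le> exp (\<epsilon> * x)" by simp
    then have "exp (- (\<epsilon> * x)) \<le> 1 / (1 + \<epsilon> * x)" using y by (simp add: exp_minus field_simps)
    also have "\<dots> \<le> 1 - \<epsilon> * x / 2"
      using y mult_left_mono [OF y(2) y(1)] by (simp add: field_simps)
    finally show ?thesis .
  qed
  moreover have "exp (- (\<epsilon> * Re (h (Suc m)))) \<le> exp (- (\<epsilon> * x))" using x assms(1) by simp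
  ultimately have "exp (- (\<epsilon> * Re (h (Suc m)))) \<le> 1 - \<epsilon> * x / 2" by linarith
  then have "norm (F * exp (- of_real \<epsilon> * h (Suc m))) \<le> 2 / \<epsilon> * (1 - \<epsilon> * x / 2)"
    unfolding norm_mult using Suc assms(1) by (intro mult_mono) (simp_all add: F_def)
  also have "\<dots> = 2 / \<epsilon> - x" using assms(1) by (simp add: field_simps)
  finally show ?case unfolding eq using norm_triangle_ineq [of "F * exp (- of_real \<epsilon> * h (Suc m))" "f (Suc m)"]
    by (simp add: x_def)
qed

lemma sum_power_tail_le:
  fixes x :: real
  assumes "0 \<le> x" "x < 1"
  shows "(\<Sum>l\<in>{j..m}. x ^ l) \<le> x ^ j / (1 - x)"
proof (cases "j \<le> m")
  case True
  then have "(\<Sum>l\<in>{j..m}. x ^ l) = (x ^ j - x ^ Suc m) / (1 - x)"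
    using assms by (simp add: sum_gp)
  also have "\<dots> \<le> x ^ j / (1 - x)" using assms by (intro divide_right_mono) auto
  finally show ?thesis .
qed (use assms in auto)

lemma sum_half_power_tail_le: "(\<Sum>l\<in>{j<..m}. (1/2::real) ^ l) \<le> (1/2) ^ j"
proof -
  have "{j<..m} = {Suc j..m}" by auto
  then show ?thesis using sum_power_tail_le [of "1/2" "Suc j" m] by simp
qed

text \<open>Meant for the tails of the sum of majorants: they inherit the geometric decay of the
  single terms, without loss in the constant.\<close>

lemma integral_norm_sum_tail_le:
  fixes h :: "nat \<Rightarrow> real \<Rightarrow> complex"
  assumes cont: "\<And>l. continuous_on {0..1} (h l)"
    and bound: "\<And>l. integral {0..1} (\<lambda>t. (norm (h l t))\<^sup>2) \<le> C * (1/4) ^ l"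
    and "C \<ge> 0"
  shows "integral {0..1} (\<lambda>t. (norm (\<Sum>l\<in>{j<..m}. h l t))\<^sup>2) \<le> C * (1/4) ^ j"
proof -
  \<comment> \<open>Cauchy-Schwarz with the weights \<open>2\<^sup>l\<close> replaces Minkowski's inequality in \<open>L\<^sup>2\<close>.\<close>
  have pt: "(norm (\<Sum>l\<in>{j<..m}. h l t))\<^sup>2 \<le> (1/2) ^ j * (\<Sum>l\<in>{j<..m}. 2 ^ l * (norm (h l t))\<^sup>2)" for t
  proof -
    have "(norm (\<Sum>l\<in>{j<..m}. h l t))\<^sup>2 \<le> (\<Sum>l\<in>{j<..m}. norm (h l t))\<^sup>2"
      by (intro power_mono norm_sum) simp
    also have "\<dots> = (\<Sum>l\<in>{j<..m}. sqrt ((1/2) ^ l) * (sqrt (2 ^ l) * norm (h l t)))\<^sup>2"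
      by (intro arg_cong [where f = "\<lambda>x. x\<^sup>2"] sum.cong)
        (simp_all add: power_one_over flip: mult.assoc real_sqrt_mult)
    also have "\<dots> \<le> (\<Sum>l\<in>{j<..m}. (sqrt ((1/2) ^ l))\<^sup>2) * (\<Sum>l\<in>{j<..m}. (sqrt (2 ^ l) * norm (h l t))\<^sup>2)"
      by (rule Cauchy_Schwarz_ineq_sum)
    also have "\<dots> = (\<Sum>l\<in>{j<..m}. (1/2) ^ l) * (\<Sum>l\<in>{j<..m}. 2 ^ l * (norm (h l t))\<^sup>2)"
      by (simp add: power_mult_distrib)
    also have "\<dots> \<le> (1/2) ^ j * (\<Sum>l\<in>{j<..m}. 2 ^ l * (norm (h l t))\<^sup>2)"
      by (intro mult_right_mono sum_half_power_tail_le sum_nonneg) simp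
    finally show ?thesis .
  qed
  have "integral {0..1} (\<lambda>t. (norm (\<Sum>l\<in>{j<..m}. h l t))\<^sup>2) \<le>
      integral {0..1} (\<lambda>t. (1/2) ^ j * (\<Sum>l\<in>{j<..m}. 2 ^ l * (norm (h l t))\<^sup>2))"
    using pt by (intro integral_le integrable_continuous_real continuous_intros cont)
  also have "\<dots> = (1/2) ^ j * (\<Sum>l\<in>{j<..m}. 2 ^ l * integral {0..1} (\<lambda>t. (norm (h l t))\<^sup>2))"
    by (simp add: integral_sum integrable_continuous_real continuous_intros cont)
  also have "\<dots> \<le> (1/2) ^ j * (\<Sum>l\<in>{j<..m}. 2 ^ l * (C * (1/4) ^ l))"
    by (intro mult_left_mono sum_mono bound) auto
  also have "\<dots> = C * (1/2) ^ j * (\<Sum>l\<in>{j<..m}. (1/2) ^ l)"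
  proof -
    have "2 ^ l * (C * (1/4) ^ l) = C * (1/2::real) ^ l" for l
      by (simp add: power_mult_distrib [symmetric])
    then have "(\<Sum>l\<in>{j<..m}. 2 ^ l * (C * (1/4) ^ l)) = C * (\<Sum>l\<in>{j<..m}. (1/2) ^ l)"
      by (simp only: sum_distrib_left)
    then show ?thesis by simp
  qed
  also have "\<dots> \<le> C * (1/2) ^ j * (1/2) ^ j"
    using \<open>C \<ge> 0\<close> by (intro mult_left_mono sum_half_power_tail_le) auto
  also have "\<dots> = C * (1/4) ^ j" by (simp add: power_mult_distrib [symmetric])
  finally show ?thesis .
qed

section \<open>The McGehee-Pigno-Smith inequality\<close>

text \<open>The constant is 432 = 6 * 72: the test function is bounded by 72, and its pairing with
  the k-th term is at least a sixth of the k-th summand on the left.\<close>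

lemma McGehee_Pigno_Smith:
  fixes n :: "nat \<Rightarrow> int" and c :: "nat \<Rightarrow> complex"
  assumes mono: "strict_mono_on {..<N} n"
  shows "(\<Sum>k<N. norm (c k) / real (Suc k)) / 432 \<le>
    integral {0..1} (\<lambda>t. norm (\<Sum>k<N. c k * e (of_int (n k) * t)))"
proof -
  \<comment> \<open>Block j consists of the k with k + 1 in [4^j, 4^(j+1)), so that 1/(k+1) is
    comparable with 4^(-j) there; the shift matches indices starting at 0.\<close>
  have "\<exists>j. 4 ^ j \<le> Suc k \<and> Suc k < 4 ^ Suc j" for k
    using ex_power_ivl1 [of 4 "Suc k"] by auto
  then obtain \<beta> where \<beta>: "\<And>k. 4 ^ \<beta> k \<le> Suc k" "\<And>k. Suc k < 4 ^ Suc (\<beta> k)" by metis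
  define B where "B j = {k. k < N \<and> \<beta> k = j}" for j
  have fin: "finite (B j)" for j by (simp add: B_def)
  have card_B: "real (card (B j)) \<le> 3 * 4 ^ j" for j
  proof -
    have "B j \<subseteq> {4 ^ j - 1..<4 ^ Suc j - 1}"
    proof
      fix k assume "k \<in> B j"
      then show "k \<in> {4 ^ j - 1..<4 ^ Suc j - 1}" using \<beta>(1) [of k] \<beta>(2) [of k] by (auto simp: B_def)
    qed
    then have "card (B j) \<le> card {4 ^ j - 1..<4 ^ Suc j - 1 :: nat}" by (intro card_mono) auto
    then have "card (B j) \<le> 3 * 4 ^ j" by simp
    then have "real (card (B j)) \<le> real (3 * 4 ^ j)" by (simp only: of_nat_le_iff)
    then show ?thesis by simp
  qed
  have inj: "inj_on n {..<N}" using mono by (rule strict_mono_on_imp_inj_on)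
  define u where "u k = cnj (sgn (c k))" for k
  have cu: "c k * u k = of_real (norm (c k))" for k
    by (simp add: u_def sgn_eq complex_norm_square [symmetric] power2_eq_square)
  have u_le: "norm (u k) \<le> 1" for k by (simp add: u_def norm_sgn)
  \<comment> \<open>The reciprocal of the maximal block size 3 * 4^j. It gives \<open>f j\<close>
    modulus at most 1 pointwise, and a squared L^2 norm of order 4^(-j).\<close>
  define a :: "nat \<Rightarrow> real" where "a j = (1/4) ^ j / 3" for j
  have au: "norm (of_real (a j) * u k) \<le> a j" for j k
    using u_le [of k] unfolding norm_mult norm_of_real by (simp add: a_def mult_left_le)
  define f where "f j t = (\<Sum>k\<in>B j. (of_real (a j) * u k) * e (of_int (- n k) * t))" for j t
  have f_le: "norm (f j t) \<le> 1" for j t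
  proof -
    have "norm (f j t) \<le> (\<Sum>k\<in>B j. a j)"
      unfolding f_def by (rule sum_norm_le) (use au in \<open>simp add: norm_mult\<close>)
    also have "\<dots> \<le> 3 * 4 ^ j * a j"
      using card_B [of j] by (simp only: sum_constant) (intro mult_right_mono, auto simp: a_def)
    also have "\<dots> = 1" by (simp add: a_def power_one_over)
    finally show ?thesis .
  qed
  have cont_f: "continuous_on {0..1} (f j)" for j
    unfolding f_def by (intro continuous_intros)
  have f_L2: "integral {0..1} (\<lambda>t. (norm (f j t))\<^sup>2) \<le> (1/3) * (1/4) ^ j" for j
  proof -
    have "inj_on (\<lambda>k. - n k) (B j)"
      using inj by (auto simp: inj_on_def B_def)
    from integral_norm_exp_poly_squared [OF fin this, of "\<lambda>k. of_real (a j) * u k"]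
    have "integral {0..1} (\<lambda>t. (norm (f j t))\<^sup>2) = (\<Sum>k\<in>B j. (norm (of_real (a j) * u k))\<^sup>2)"
      unfolding f_def by (rule integral_unique)
    also have "\<dots> \<le> (\<Sum>k\<in>B j. (a j)\<^sup>2)"
      by (intro sum_mono power_mono au) auto
    also have "\<dots> \<le> 3 * 4 ^ j * (a j)\<^sup>2"
      using card_B [of j] by (simp only: sum_constant) (intro mult_right_mono, auto)
    also have "\<dots> = (1/3) * (1/4) ^ j" by (simp add: a_def power2_eq_square power_one_over)
    finally show ?thesis .
  qed
  have "\<exists>p. (\<forall>t. norm (f j t) \<le> Re (poly p (e t))) \<and>
      integral {0..1} (\<lambda>t. (norm (poly p (e t)))\<^sup>2) \<le> 6 * (1/4) ^ j" for j
  proof -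
    \<comment> \<open>The modulus of \<open>f j\<close> as a function on the circle, with
      \<open>powi\<close> for frequencies of either sign. The slack \<open>(1/2) ^ j\<close> has
      square 4^(-j), the order of the squared L^2 norm of \<open>f j\<close>, so the majorant keeps
      this order.\<close>
    define \<phi> where "\<phi> z = norm (\<Sum>k\<in>B j. (of_real (a j) * u k) * z powi (- n k))" for z
    have \<phi>: "\<phi> (e t) = norm (f j t)" for t by (simp add: \<phi>_def f_def flip: e_of_int_mult)
    obtain p where p: "\<And>z. norm z = 1 \<Longrightarrow> \<phi> z \<le> Re (poly p z)"
      "integral {0..1} (\<lambda>t. (norm (poly p (e t)))\<^sup>2) \<le> 2 * integral {0..1} (\<lambda>t. (\<phi> (e t) + (1/2) ^ j)\<^sup>2)"
    proof (rule ex_poly_analytic_majorant [of \<phi> "(1/2) ^ j"])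
      show "continuous_on (sphere 0 1) \<phi>"
        unfolding \<phi>_def by (intro continuous_intros) auto
    qed (auto simp: \<phi>_def)
    have "integral {0..1} (\<lambda>t. (\<phi> (e t) + (1/2) ^ j)\<^sup>2) \<le>
        integral {0..1} (\<lambda>t. 2 * (norm (f j t))\<^sup>2 + 2 * (1/4) ^ j)"
    proof (intro integral_le integrable_continuous_real, unfold \<phi>)
      fix t
      have "(norm (f j t) + (1/2) ^ j)\<^sup>2 \<le> 2 * (norm (f j t))\<^sup>2 + 2 * ((1/2) ^ j)\<^sup>2"
        using sum_squares_ge_zero [of "norm (f j t) - (1/2) ^ j" 0]
        by (simp add: power2_eq_square algebra_simps)
      also have "((1/2::real) ^ j)\<^sup>2 = (1/4) ^ j" by (simp add: power2_eq_square flip: power_mult_distrib)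
      finally show "(norm (f j t) + (1/2) ^ j)\<^sup>2 \<le> 2 * (norm (f j t))\<^sup>2 + 2 * (1/4) ^ j" .
    qed (intro continuous_intros cont_f)+
    also have "\<dots> = 2 * integral {0..1} (\<lambda>t. (norm (f j t))\<^sup>2) + 2 * (1/4) ^ j"
      by (simp add: integral_add integrable_continuous_real continuous_intros cont_f)
    also have "\<dots> \<le> 3 * (1/4) ^ j"
    proof -
      have "(0::real) \<le> (1/4) ^ j" by simp
      then show ?thesis using f_L2 [of j] by linarith
    qed
    finally show ?thesis using p by (intro exI [of _ p]) (auto simp flip: \<phi>)
  qed
  then obtain P where P: "\<And>j t. norm (f j t) \<le> Re (poly (P j) (e t))"
    "\<And>j. integral {0..1} (\<lambda>t. (norm (poly (P j) (e t)))\<^sup>2) \<le> 6 * (1/4) ^ j"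
    by metis
  \<comment> \<open>Small enough for the total error 4 \<epsilon> * (4/3) * 4^(-j) at a frequency of
    block j to be at most half of the main term 4^(-j)/3.\<close>
  define \<epsilon> :: real where "\<epsilon> = 1/36"
  define H where "H j z = (\<Sum>l\<in>{j<..N}. poly (P l) z)" for j z
  \<comment> \<open>The test function. The factors \<open>exp (- \<epsilon> H\<^sub>j)\<close> keep it bounded, and since they have only
    nonnegative frequencies while those of \<open>f\<^sub>j\<close> are the \<open>- n l\<close> with \<open>l\<close> in block \<open>j\<close>, its coefficient
    at \<open>- n k\<close> is unaffected by the blocks before that of \<open>k\<close>.\<close>
  define F where "F t = (\<Sum>j\<le>N. f j t * exp (- of_real \<epsilon> * H j (e t)))" for t
  have F_le: "norm (F t) \<le> 72" for t
    using norm_exp_recursion_le [of \<epsilon> "\<lambda>j. f j t" "\<lambda>j. poly (P j) (e t)" N] f_le P(1)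
    by (simp add: F_def H_def \<epsilon>_def)
  have cont_H: "continuous_on {0..1} (\<lambda>t. H j (e t))" for j
    unfolding H_def by (intro continuous_intros)
  have cont_F: "continuous_on {0..1} F"
    unfolding F_def by (intro continuous_intros cont_f cont_H)
  \<comment> \<open>\<open>G j\<close> is the deviation of the damping factor from 1.
    \<open>E k j\<close> is thus the error that damping block j causes in the coefficient paired
    with c k.\<close>
  define G where "G j t = exp (- of_real \<epsilon> * H j (e t)) - 1" for j t
  have cont_G: "continuous_on {0..1} (G j)" for j
    unfolding G_def by (intro continuous_intros cont_H)
  define E where "E k j = integral {0..1} (\<lambda>t. e (of_int (n k) * t) * f j t * G j t)" for k j
  have E_0: "E k j = 0" if "k < N" "j < \<beta> k" for k j
  proof -
    have "((\<lambda>t. \<Sum>l\<in>B j. of_real (a j) * u l * (e (of_int (n k - n l) * t) * G j t)) has_integral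
        (\<Sum>l\<in>B j. of_real (a j) * u l * 0)) {0..1}"
    proof (intro has_integral_sum has_integral_mult_right fin)
      fix l assume l: "l \<in> B j"
      have "l < k"
      proof (rule ccontr)
        assume "\<not> l < k"
        have "4 ^ Suc (\<beta> l) \<le> (4::nat) ^ \<beta> k"
          using l that by (intro power_increasing) (auto simp: B_def)
        then show False using \<beta>(1) [of k] \<beta>(2) [of l] \<open>\<not> l < k\<close> by linarith
      qed
      then have "n l < n k" using mono that by (auto simp: strict_mono_on_def)
      \<comment> \<open>A positive power of z times an entire function vanishes at 0, hence has mean
        0 on the circle.\<close>
      define d where "d = nat (n k - n l)"
      have d: "n k - n l = int d" "d > 0" using \<open>n l < n k\<close> by (auto simp: d_def)
      have "((\<lambda>t. e t ^ d * (exp (- of_real \<epsilon> * H j (e t)) - 1)) has_integral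
          0 ^ d * (exp (- of_real \<epsilon> * H j 0) - 1)) {0..1}"
        unfolding H_def by (rule has_integral_entire_e) (intro holomorphic_intros)
      then show "((\<lambda>t. e (of_int (n k - n l) * t) * G j t) has_integral 0) {0..1}"
        using d by (simp add: G_def e_of_nat_mult zero_power)
    qed
    moreover have "e (of_int (n k) * t) * f j t * G j t =
        (\<Sum>l\<in>B j. of_real (a j) * u l * (e (of_int (n k - n l) * t) * G j t))" for t
      unfolding f_def sum_distrib_left sum_distrib_right e_int_diff by (simp add: mult_ac)
    ultimately show ?thesis unfolding E_def by (simp add: integral_unique)
  qed
  \<comment> \<open>\<open>G j\<close> is at most \<epsilon> times the modulus of
    \<open>H j\<close>, and the product with \<open>f j\<close> is split by the arithmetic-geometric
    mean inequality into the two known L^2 bounds; 1/3 + 6, halved, is below 4.\<close>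
  have E_le: "norm (E k j) \<le> 4 * \<epsilon> * (1/4) ^ j" for k j
  proof -
    have H_L2: "integral {0..1} (\<lambda>t. (norm (H j (e t)))\<^sup>2) \<le> 6 * (1/4) ^ j"
      unfolding H_def
      by (rule integral_norm_sum_tail_le) (use P(2) in \<open>auto intro!: continuous_intros\<close>)
    have "norm (E k j) \<le> integral {0..1} (\<lambda>t. \<epsilon> / 2 * ((norm (f j t))\<^sup>2 + (norm (H j (e t)))\<^sup>2))"
      unfolding E_def
    proof (intro integral_norm_bound_integral integrable_continuous_real)
      fix t
      have "0 \<le> Re (H j (e t))"
        unfolding H_def Re_sum using P(1) by (intro sum_nonneg) (meson norm_ge_zero order_trans)
      then have "norm (G j t) \<le> \<epsilon> * norm (H j (e t))"
        using norm_exp_minus_one_le [of "of_real \<epsilon> * H j (e t)"] by (simp add: G_def \<epsilon>_def norm_mult)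
      then have "norm (e (of_int (n k) * t) * f j t * G j t) \<le> norm (f j t) * (\<epsilon> * norm (H j (e t)))"
        by (simp add: norm_mult mult_left_mono)
      also have "\<dots> \<le> \<epsilon> / 2 * ((norm (f j t))\<^sup>2 + (norm (H j (e t)))\<^sup>2)"
        using sum_squares_bound [of "norm (f j t)" "norm (H j (e t))"] by (simp add: \<epsilon>_def)
      finally show "norm (e (of_int (n k) * t) * f j t * G j t) \<le>
          \<epsilon> / 2 * ((norm (f j t))\<^sup>2 + (norm (H j (e t)))\<^sup>2)" .
    qed (intro continuous_intros cont_f cont_G cont_H)+
    also have "\<dots> = \<epsilon> / 2 * (integral {0..1} (\<lambda>t. (norm (f j t))\<^sup>2) + integral {0..1} (\<lambda>t. (norm (H j (e t)))\<^sup>2))"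
      by (simp add: integral_add integrable_continuous_real continuous_intros cont_f cont_H)
    also have "\<dots> \<le> \<epsilon> / 2 * ((1/3) * (1/4) ^ j + 6 * (1/4) ^ j)"
      using f_L2 [of j] H_L2 by (intro mult_left_mono add_mono) (auto simp: \<epsilon>_def)
    also have "\<dots> \<le> 4 * \<epsilon> * (1/4) ^ j" by (simp add: \<epsilon>_def)
    finally show ?thesis .
  qed
  have main: "norm (c k) / real (Suc k) / 6 \<le> Re (c k * integral {0..1} (\<lambda>t. e (of_int (n k) * t) * F t))"
    if k: "k < N" for k
  proof -
    \<comment> \<open>Ensures that the block of k occurs in the sum over j \<le> N defining
      \<open>F\<close>.\<close>
    have "\<beta> k \<le> N"
    proof (rule ccontr)
      assume "\<not> \<beta> k \<le> N"
      then have "(4::nat) ^ N \<le> 4 ^ \<beta> k" by (intro power_increasing) auto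
      moreover have "N < (4::nat) ^ N" by (rule less_exp [THEN less_le_trans]) (simp add: power_mono)
      ultimately show False using \<beta>(1) [of k] k by linarith
    qed
    have coeff_f: "((\<lambda>t. e (of_int (n k) * t) * f j t) has_integral
        (if j = \<beta> k then of_real (a j) * u k else 0)) {0..1}" for j
    proof -
      have "((\<lambda>t. \<Sum>l\<in>B j. of_real (a j) * u l * e (of_int (n k - n l) * t)) has_integral
          (\<Sum>l\<in>B j. of_real (a j) * u l * (if n k - n l = 0 then 1 else 0))) {0..1}"
        by (intro has_integral_sum has_integral_mult_right has_integral_e_int fin)
      moreover have "e (of_int (n k) * t) * f j t =
          (\<Sum>l\<in>B j. of_real (a j) * u l * e (of_int (n k - n l) * t))" for t
        unfolding f_def sum_distrib_left e_int_diff by (simp add: mult_ac)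
      moreover have "(\<Sum>l\<in>B j. of_real (a j) * u l * (if n k - n l = 0 then 1 else 0)) =
          (\<Sum>l\<in>B j. if l = k then of_real (a j) * u l else 0)"
        using inj k by (intro sum.cong) (auto simp: B_def dest: inj_onD)
      moreover have "\<dots> = (if j = \<beta> k then of_real (a j) * u k else 0)"
        using fin k by (auto simp: B_def sum.delta)
      ultimately show ?thesis by simp
    qed
    have "(\<lambda>t. e (of_int (n k) * t) * F t) =
        (\<lambda>t. \<Sum>j\<le>N. e (of_int (n k) * t) * f j t + e (of_int (n k) * t) * f j t * G j t)"
      by (simp add: F_def G_def sum_distrib_left algebra_simps)
    moreover have "((\<lambda>t. \<Sum>j\<le>N. e (of_int (n k) * t) * f j t + e (of_int (n k) * t) * f j t * G j t)
        has_integral (\<Sum>j\<le>N. (if j = \<beta> k then of_real (a j) * u k else 0) + E k j)) {0..1}"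
      unfolding E_def
      by (intro has_integral_sum has_integral_add coeff_f integrable_integral integrable_continuous_real
          continuous_intros cont_f cont_G) simp
    ultimately have "integral {0..1} (\<lambda>t. e (of_int (n k) * t) * F t) =
        (\<Sum>j\<le>N. (if j = \<beta> k then of_real (a j) * u k else 0) + E k j)"
      by (simp add: integral_unique)
    also have "\<dots> = of_real (a (\<beta> k)) * u k + (\<Sum>j\<le>N. E k j)"
      using \<open>\<beta> k \<le> N\<close> by (simp add: sum.distrib sum.delta)
    finally have "c k * integral {0..1} (\<lambda>t. e (of_int (n k) * t) * F t) =
        of_real (a (\<beta> k) * norm (c k)) + c k * (\<Sum>j\<le>N. E k j)"
      by (simp add: algebra_simps flip: cu)
    then have "Re (c k * integral {0..1} (\<lambda>t. e (of_int (n k) * t) * F t)) =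
        a (\<beta> k) * norm (c k) + Re (c k * (\<Sum>j\<le>N. E k j))"
      by simp
    \<comment> \<open>Only the block of k and later ones contribute, so the error is a geometric
      tail starting at 4^(-\<open>\<beta> k\<close>).\<close>
    moreover have "norm (\<Sum>j\<le>N. E k j) \<le> (1/4) ^ \<beta> k / 6"
    proof -
      have "(\<Sum>j\<le>N. E k j) = (\<Sum>j\<in>{\<beta> k..N}. E k j)"
        using E_0 k by (intro sum.mono_neutral_right) auto
      also have "norm \<dots> \<le> (\<Sum>j\<in>{\<beta> k..N}. 4 * \<epsilon> * (1/4) ^ j)"
        by (intro sum_norm_le E_le)
      also have "\<dots> = 4 * \<epsilon> * (\<Sum>j\<in>{\<beta> k..N}. (1/4) ^ j)" by (simp add: sum_distrib_left)
      also have "\<dots> \<le> 4 * \<epsilon> * ((1/4) ^ \<beta> k / (1 - 1/4))"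
        by (intro mult_left_mono sum_power_tail_le) (auto simp: \<epsilon>_def)
      also have "\<dots> \<le> (1/4) ^ \<beta> k / 6" by (simp add: \<epsilon>_def)
      finally show ?thesis .
    qed
    then have "norm (c k * (\<Sum>j\<le>N. E k j)) \<le> norm (c k) * ((1/4) ^ \<beta> k / 6)"
      unfolding norm_mult by (rule mult_left_mono) simp
    moreover have "- norm (c k * (\<Sum>j\<le>N. E k j)) \<le> Re (c k * (\<Sum>j\<le>N. E k j))"
      using abs_Re_le_cmod [of "c k * (\<Sum>j\<le>N. E k j)"] by linarith
    ultimately have "norm (c k) * ((1/4) ^ \<beta> k / 6) \<le> Re (c k * integral {0..1} (\<lambda>t. e (of_int (n k) * t) * F t))"
      by (simp add: a_def)
    moreover have "1 / real (Suc k) \<le> (1/4) ^ \<beta> k"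
    proof -
      have "real (4 ^ \<beta> k) \<le> real (Suc k)" using \<beta>(1) by (simp only: of_nat_le_iff)
      then show ?thesis by (simp add: power_one_over divide_simps)
    qed
    then have "norm (c k) * (1 / real (Suc k) / 6) \<le> norm (c k) * ((1/4) ^ \<beta> k / 6)"
      by (intro mult_left_mono divide_right_mono) auto
    ultimately show ?thesis unfolding times_divide_eq_right mult_1_right by (rule order_trans [rotated])
  qed
  define T where "T t = (\<Sum>k<N. c k * e (of_int (n k) * t))" for t
  have cont_T: "continuous_on {0..1} T" unfolding T_def by (intro continuous_intros)
  \<comment> \<open>Duality: the pairing of \<open>T\<close> with \<open>F\<close> is bounded below
    term by term through \<open>main\<close>, and above by 72 times the L^1 norm of
    \<open>T\<close>.\<close>
  have "(\<Sum>k<N. norm (c k) / real (Suc k)) / 6 \<le>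
      (\<Sum>k<N. Re (c k * integral {0..1} (\<lambda>t. e (of_int (n k) * t) * F t)))"
    unfolding sum_divide_distrib by (intro sum_mono main) auto
  also have "\<dots> = Re (integral {0..1} (\<lambda>t. T t * F t))"
  proof -
    have "integral {0..1} (\<lambda>t. T t * F t) = (\<Sum>k<N. c k * integral {0..1} (\<lambda>t. e (of_int (n k) * t) * F t))"
      by (simp add: T_def sum_distrib_right mult.assoc integral_sum integrable_continuous_real
          continuous_intros cont_F)
    then show ?thesis by simp
  qed
  also have "\<dots> \<le> norm (integral {0..1} (\<lambda>t. T t * F t))" by (rule complex_Re_le_cmod)
  also have "\<dots> \<le> integral {0..1} (\<lambda>t. norm (T t) * 72)"
    using F_le by (intro integral_norm_bound_integral integrable_continuous_real continuous_intros cont_T cont_F)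
      (auto simp: norm_mult intro: mult_left_mono)
  also have "\<dots> = integral {0..1} (\<lambda>t. norm (T t)) * 72" by simp
  finally show ?thesis by (simp add: T_def)
qed

section \<open>Iterated integration over the two-dimensional torus\<close>

lemma UNIV_2_eq_insert:
  fixes i j :: 2
  assumes "i \<noteq> j"
  shows "UNIV = {i, j}"
  using assms UNIV_2 exhaust_2 [of i] exhaust_2 [of j] by auto

text \<open>The coordinate \<open>i\<close>, constant on rows, is taken from the second component,
  so the inner integral always runs across the rows and both directions are treated alike.\<close>

definition plane_point :: "2 \<Rightarrow> real \<times> real \<Rightarrow> real ^ 2" where
  "plane_point i p = (\<chi> k. if k = i then snd p else fst p)"

lemma continuous_on_plane_point: "continuous_on S (plane_point i)"
proof -
  have "continuous_on S (\<lambda>p. if k = i then snd p else fst p)" for k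
    by (cases "k = i") (auto intro!: continuous_intros)
  then show ?thesis
    unfolding plane_point_def by (intro continuous_on_vec_lambda)
qed

lemma measurable_plane_point: "plane_point i \<in> borel_measurable (lborel \<Otimes>\<^sub>M lborel)"
  using continuous_on_plane_point [of UNIV i]
  by (simp add: lborel_prod borel_measurable_continuous_onI)

text \<open>Lebesgue measure is determined by its values on boxes, and a box pulls back to a
  rectangle with the same side lengths.\<close>

lemma distr_plane_point: "distr (lborel \<Otimes>\<^sub>M lborel) borel (plane_point i) = lborel"
proof -
  note [measurable] = measurable_plane_point
  obtain j :: 2 where ij: "i \<noteq> j" by (metis zero_neq_one)
  note UNIV2 = UNIV_2_eq_insert [OF ij]
  have "lborel = distr (lborel \<Otimes>\<^sub>M lborel) borel (plane_point i)"
  proof (rule lborel_eqI)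
    fix l u :: "real ^ 2" assume le: "\<And>b. b \<in> Basis \<Longrightarrow> l \<bullet> b \<le> u \<bullet> b"
    have le': "l $ k \<le> u $ k" for k using le [of "axis k 1"] by (simp add: axis_in_Basis_iff inner_axis)
    have all2: "(\<forall>k. Q k) \<longleftrightarrow> Q i \<and> Q j" for Q using UNIV2 by (metis UNIV_I insertE singletonD)
    have "plane_point i -` box l u = {l $ j<..<u $ j} \<times> {l $ i<..<u $ i}"
      using ij by (auto simp: plane_point_def mem_box_cart all2)
    then have "emeasure (distr (lborel \<Otimes>\<^sub>M lborel) borel (plane_point i)) (box l u) =
        emeasure (lborel \<Otimes>\<^sub>M lborel) ({l $ j<..<u $ j} \<times> {l $ i<..<u $ i})"
      by (simp add: emeasure_distr space_pair_measure)
    also have "\<dots> = ennreal (u $ j - l $ j) * ennreal (u $ i - l $ i)"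
      using le' by (subst lborel.emeasure_pair_measure_Times) auto
    also have "\<dots> = (\<Prod>b\<in>Basis. (u - l) \<bullet> b)"
    proof -
      have B: "(Basis :: (real ^ 2) set) = {axis i 1, axis j 1}"
        unfolding Basis_vec_def UNIV2 by auto
      have "axis i 1 \<noteq> (axis j 1 :: real ^ 2)" using ij by (simp add: axis_eq_axis)
      then have "(\<Prod>b\<in>Basis. (u - l) \<bullet> b) = (u $ i - l $ i) * (u $ j - l $ j)"
        unfolding B by (simp add: inner_axis)
      then show ?thesis using le' by (simp add: ennreal_mult mult.commute)
    qed
    finally show "emeasure (distr (lborel \<Otimes>\<^sub>M lborel) borel (plane_point i)) (box l u) =
        (\<Prod>b\<in>Basis. (u - l) \<bullet> b)" .
  qed simp
  then show ?thesis by simp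
qed

lemma torus_L1_norm_iterated:
  fixes f :: "real ^ 2 \<Rightarrow> complex"
  assumes f: "continuous_on UNIV f"
  shows "torus_L1_norm f =
    integral {0..1} (\<lambda>x. integral {0..1} (\<lambda>y. norm (f (plane_point i (x, y)))))"
proof -
  note [measurable] = measurable_plane_point
  have [measurable]: "f \<in> borel_measurable borel" using f by (rule borel_measurable_continuous_onI)
  have [measurable]: "unit_cube \<in> sets (borel :: (real ^ 2) measure)" by (simp add: unit_cube_eq_cbox)
  obtain j :: 2 where ij: "i \<noteq> j" by (metis zero_neq_one)
  have all2: "(\<forall>k. Q k) \<longleftrightarrow> Q i \<and> Q j" for Q
    using UNIV_2_eq_insert [OF ij] by (metis UNIV_I insertE singletonD)
  have cube: "plane_point i p \<in> unit_cube \<longleftrightarrow> p \<in> cbox (0, 0) (1, 1)" for p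
    using ij by (cases p) (auto simp: plane_point_def unit_cube_def all2)
  have cont: "continuous_on S (\<lambda>p. norm (f (plane_point i p)))" for S
    by (intro continuous_on_norm continuous_on_compose2 [OF f continuous_on_plane_point]) auto
  have "torus_L1_norm f =
      (\<integral>v. indicator unit_cube v *\<^sub>R norm (f v) \<partial>distr (lborel \<Otimes>\<^sub>M lborel) borel (plane_point i))"
    unfolding torus_L1_norm_def set_lebesgue_integral_def distr_plane_point ..
  also have "\<dots> = (\<integral>p. indicator unit_cube (plane_point i p) *\<^sub>R norm (f (plane_point i p)) \<partial>(lborel \<Otimes>\<^sub>M lborel))"
    by (rule integral_distr) measurable
  also have "\<dots> = (LINT p:cbox (0, 0) (1, 1)|lborel. norm (f (plane_point i p)))"
    unfolding set_lebesgue_integral_def by (simp add: lborel_prod indicator_def cube)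
  also have "\<dots> = integral (cbox (0, 0) (1, 1)) (\<lambda>p. norm (f (plane_point i p)))"
    by (rule set_borel_integral_eq_integral, unfold set_integrable_def, rule borel_integrable_compact)
      (auto intro: cont)
  also have "\<dots> = integral {0..1} (\<lambda>x. integral {0..1} (\<lambda>y. norm (f (plane_point i (x, y)))))"
    using integral_prod_continuous [OF cont, of 0 0 1 1] by simp
  finally show ?thesis .
qed

section \<open>Rows and the final bound\<close>

text \<open>The weights are 1/432 times the reciprocal rank in \<open>K\<close>, so their sum is a
  harmonic number over 432. They are fixed before the coefficients c, which allows c to vary with x
  when the inequality is integrated.\<close>

lemma McGehee_Pigno_Smith_weights:
  fixes K :: "int set"
  assumes "finite K"
  obtains w where "\<And>k. w k \<ge> 0" "ln (card K) / 432 \<le> sum w K"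
    "\<And>c. (\<Sum>k\<in>K. w k * norm (c k)) \<le> integral {0..1} (\<lambda>t. norm (\<Sum>k\<in>K. c k * e (of_int k * t)))"
proof -
  define N where "N = card K"
  define n where "n k = sorted_list_of_set K ! k" for k
  have len: "length (sorted_list_of_set K) = N" by (simp add: N_def)
  have mono: "strict_mono_on {..<N} n"
    unfolding n_def strict_mono_on_def
    using sorted_wrt_nth_less [OF strict_sorted_list_of_set] len by auto
  have bij: "bij_betw n {..<N} K"
    unfolding n_def using assms len by (intro bij_betw_nth) auto
  define w where "w k = 1 / real (Suc (inv_into {..<N} n k)) / 432" for k
  have w: "w (n k) = 1 / real (Suc k) / 432" if "k < N" for k
    using that bij by (simp add: w_def bij_betw_def)
  show ?thesis
  proof
    show "w k \<ge> 0" for k by (simp add: w_def)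
    have "ln (real N) \<le> harm N"
    proof (cases "N = 0")
      case False
      then have "ln (real N) \<le> ln (real N + 1)" by simp
      also have "\<dots> \<le> harm N" by (rule ln_le_harm)
      finally show ?thesis .
    qed (simp add: harm_def)
    also have "harm N = (\<Sum>k<N. 1 / real (Suc k))"
      by (simp add: harm_def inverse_eq_divide sum.atLeast1_atMost_eq)
    finally have "ln (real N) / 432 \<le> (\<Sum>k<N. 1 / real (Suc k) / 432)"
      unfolding sum_divide_distrib [symmetric] by (rule divide_right_mono) simp
    also have "\<dots> = (\<Sum>k<N. w (n k))" by (simp add: w)
    also have "\<dots> = sum w K" by (rule sum.reindex_bij_betw [OF bij])
    finally show "ln (real (card K)) / 432 \<le> sum w K" by (simp add: N_def)
  next
    fix c :: "int \<Rightarrow> complex"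
    have "(\<Sum>k\<in>K. w k * norm (c k)) = (\<Sum>k<N. w (n k) * norm (c (n k)))"
      by (rule sum.reindex_bij_betw [OF bij, symmetric])
    also have "\<dots> = (\<Sum>k<N. norm (c (n k)) / real (Suc k)) / 432"
      unfolding sum_divide_distrib by (intro sum.cong) (simp_all add: w)
    also have "\<dots> \<le> integral {0..1} (\<lambda>t. norm (\<Sum>k<N. c (n k) * e (of_int (n k) * t)))"
      by (rule McGehee_Pigno_Smith [OF mono])
    also have "\<dots> = integral {0..1} (\<lambda>t. norm (\<Sum>k\<in>K. c k * e (of_int k * t)))"
      by (simp add: sum.reindex_bij_betw [OF bij, of "\<lambda>k. c k * e (of_int k * _)"])
    finally show "(\<Sum>k\<in>K. w k * norm (c k)) \<le>
        integral {0..1} (\<lambda>t. norm (\<Sum>k\<in>K. c k * e (of_int k * t)))" .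
  qed
qed

lemma inj_on_row:
  fixes A :: "(int ^ 2) set"
  assumes "i \<noteq> j"
  shows "inj_on (\<lambda>v. v $ j) {v \<in> A. v $ i = k}"
  using UNIV_2_eq_insert [OF assms] by (auto simp: inj_on_def vec_eq_iff) (metis UNIV_I insertE singletonD)

text \<open>Grouping points by row turns the sum into a trigonometric polynomial in y whose
  coefficients are the row sums in x.\<close>

lemma exp_sum_plane_point:
  fixes A :: "(int ^ 2) set"
  assumes "finite A" "i \<noteq> j"
  shows "exp_sum A (plane_point i (x, y)) =
    (\<Sum>k\<in>(\<lambda>v. v $ i) ` A. (\<Sum>b\<in>(\<lambda>v. v $ j) ` {v \<in> A. v $ i = k}. e (of_int b * x)) * e (of_int k * y))"
proof -
  have "exp_sum A (plane_point i (x, y)) = (\<Sum>v\<in>A. e (of_int (v $ j) * x) * e (of_int (v $ i) * y))"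
    using assms(2) by (simp add: exp_sum_def UNIV_2_eq_insert [OF assms(2)] plane_point_def e_add [symmetric] add.commute)
  also have "\<dots> = (\<Sum>k\<in>(\<lambda>v. v $ i) ` A. \<Sum>v\<in>{v \<in> A. v $ i = k}. e (of_int (v $ j) * x) * e (of_int (v $ i) * y))"
    by (rule sum.image_gen [OF assms(1)])
  also have "\<dots> = (\<Sum>k\<in>(\<lambda>v. v $ i) ` A. (\<Sum>b\<in>(\<lambda>v. v $ j) ` {v \<in> A. v $ i = k}. e (of_int b * x)) * e (of_int k * y))"
    by (intro sum.cong refl, subst sum.reindex)
      (auto simp: sum_distrib_right inj_on_row [OF assms(2)])
  finally show ?thesis .
qed


lemma torus_L1_norm_exp_sum_rows_ge:
  fixes A :: "(int ^ 2) set"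
  assumes "finite A" "consists_of_rows r s A" "s \<ge> 1" "r \<ge> 1"
  shows "ln s * ln r / 432\<^sup>2 \<le> torus_L1_norm (exp_sum A)"
proof -
  obtain j where j: "card {R \<in> rows_in_direction j A. R \<noteq> {}} \<ge> r"
      "\<And>R. R \<in> rows_in_direction j A \<Longrightarrow> R \<noteq> {} \<Longrightarrow> card R \<ge> s"
    using assms(2) by (auto simp: consists_of_rows_def)
  obtain i :: 2 where ij: "i \<noteq> j" by (metis zero_neq_one)
  have only_i: "i' \<noteq> j \<longleftrightarrow> i' = i" for i' using UNIV_2_eq_insert [OF ij] ij by auto
  define K where "K = (\<lambda>v. v $ i) ` A"
  define B where "B k = (\<lambda>v. v $ j) ` {v \<in> A. v $ i = k}" for k
  have fin: "finite K" "finite (B k)" for k using assms(1) by (simp_all add: K_def B_def)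
  \<comment> \<open>Each non-empty row is the level set of the coordinate \<open>i\<close> at some
    value in \<open>K\<close>, so \<open>K\<close> has at least r elements.\<close>
  have "{R \<in> rows_in_direction j A. R \<noteq> {}} \<subseteq> (\<lambda>k. A \<inter> {v. v $ i = k}) ` K"
    by (auto simp: rows_in_direction_def K_def only_i)
  then have "card {R \<in> rows_in_direction j A. R \<noteq> {}} \<le> card K"
    using fin(1) by (meson card_image_le card_mono finite_imageI order_trans)
  then have card_K: "card K \<ge> r" using j(1) by linarith
  have card_B: "card (B k) \<ge> s" if "k \<in> K" for k
  proof -
    have "A \<inter> {v. v $ i = k} \<in> rows_in_direction j A" "A \<inter> {v. v $ i = k} \<noteq> {}"
      using ij that by (auto simp: rows_in_direction_def K_def)
    then have "card (A \<inter> {v. v $ i = k}) \<ge> s" by (rule j(2))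
    then show ?thesis by (simp add: B_def card_image inj_on_row [OF ij] Int_def)
  qed
  define p where "p k x = (\<Sum>b\<in>B k. e (of_int b * x))" for k x
  have cont_p: "continuous_on S (p k)" for k S unfolding p_def by (intro continuous_intros)
  have p_ge: "ln s / 432 \<le> integral {0..1} (\<lambda>x. norm (p k x))" if "k \<in> K" for k
  proof -
    obtain w where w: "ln (card (B k)) / 432 \<le> sum w (B k)"
      "\<And>c. (\<Sum>b\<in>B k. w b * norm (c b)) \<le> integral {0..1} (\<lambda>t. norm (\<Sum>b\<in>B k. c b * e (of_int b * t)))"
      by (rule McGehee_Pigno_Smith_weights [OF fin(2) [of k]]) blast
    have "ln s \<le> ln (card (B k))" using card_B [OF that] assms(3) by simp
    then show ?thesis using w(1) w(2) [of "\<lambda>_. 1"] by (simp add: p_def)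
  qed
  obtain w where w: "\<And>k. w k \<ge> 0" "ln (card K) / 432 \<le> sum w K"
    "\<And>c. (\<Sum>k\<in>K. w k * norm (c k)) \<le> integral {0..1} (\<lambda>t. norm (\<Sum>k\<in>K. c k * e (of_int k * t)))"
    by (rule McGehee_Pigno_Smith_weights [OF fin(1)]) blast
  have "ln r \<le> ln (card K)" using card_K assms(4) by simp
  then have "ln r / 432 \<le> sum w K" using w(2) by linarith
  then have "ln s / 432 * (ln r / 432) \<le> ln s / 432 * sum w K"
    using assms(3) by (intro mult_left_mono) auto
  also have "\<dots> = (\<Sum>k\<in>K. w k * (ln s / 432))" unfolding sum_distrib_right [symmetric] by (rule mult.commute)
  also have "\<dots> \<le> (\<Sum>k\<in>K. w k * integral {0..1} (\<lambda>x. norm (p k x)))"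
    by (intro sum_mono mult_left_mono p_ge w(1))
  also have "\<dots> = integral {0..1} (\<lambda>x. \<Sum>k\<in>K. w k * norm (p k x))"
    by (simp add: integral_sum fin(1) integrable_continuous_real continuous_intros cont_p)
  also have "\<dots> \<le> integral {0..1} (\<lambda>x. integral {0..1} (\<lambda>y. norm (\<Sum>k\<in>K. p k x * e (of_int k * y))))"
  proof (rule integral_le)
    show "(\<lambda>x. \<Sum>k\<in>K. w k * norm (p k x)) integrable_on {0..1}"
      by (intro integrable_continuous_real continuous_intros cont_p)
    \<comment> \<open>Joint continuity makes the inner integral integrable in x.\<close>
    have "continuous_on (cbox (0, 0) (1, 1)) (\<lambda>z. norm (\<Sum>k\<in>K. p k (fst z) * e (of_int k * snd z)))"
      by (intro continuous_intros continuous_on_compose2 [OF cont_p [of UNIV]]) auto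
    from integral_integrable_2dim [OF this]
    show "(\<lambda>x. integral {0..1} (\<lambda>y. norm (\<Sum>k\<in>K. p k x * e (of_int k * y)))) integrable_on {0..1::real}"
      by simp
  qed (rule w(3))
  also have "\<dots> = torus_L1_norm (exp_sum A)"
  proof -
    have "continuous_on UNIV (exp_sum A)"
      unfolding exp_sum_def by (intro continuous_intros)
    then show ?thesis
      by (simp add: torus_L1_norm_iterated [of _ i] exp_sum_plane_point [OF assms(1) ij] p_def K_def B_def)
  qed
  finally show ?thesis by (simp add: power2_eq_square)
qed

theorem theorem1p2:
  shows "\<exists>c::real. c > 0 \<and>
    (\<forall>(r::nat) (s::nat) (A :: (int ^ 2) set).
       r \<ge> 3 \<longrightarrow> s \<ge> 1 \<longrightarrow> finite A \<longrightarrow> consists_of_rows r s A \<longrightarrow>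
       torus_L1_norm (exp_sum A) \<ge>
         c * ln (real s) * sqrt (ln (real r) / ln (ln (real r))))"
proof (intro exI conjI allI impI)
  \<comment> \<open>For r \<ge> 3, ln ln r is at least \<open>M\<close> > 0 and ln r is at least 1,
    so the root in the claim is at most ln r / sqrt \<open>M\<close>. The product bound ln s ln r
    then suffices.\<close>
  define M where "M = ln (ln (3::real))"
  have M: "M > 0" using ln3_gt_1 by (simp add: M_def)
  show "sqrt M / 432\<^sup>2 > 0" using M by simp
  fix r s :: nat and A :: "(int ^ 2) set"
  assume "r \<ge> 3" "s \<ge> 1" "finite A" and rows: "consists_of_rows r s A"
  have "sqrt (ln r / ln (ln r)) \<le> ln r / sqrt M"
  proof -
    have L: "ln 3 \<le> ln (real r)" using \<open>r \<ge> 3\<close> by simp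
    then have "M \<le> ln (ln r)" "1 \<le> ln (real r)" using ln3_gt_1 by (simp_all add: M_def)
    then have "ln r / ln (ln r) \<le> (ln r)\<^sup>2 / M"
      using M by (intro frac_le) (simp_all add: power2_eq_square)
    then have "sqrt (ln r / ln (ln r)) \<le> sqrt ((ln r)\<^sup>2 / M)" by (rule real_sqrt_le_mono)
    then show ?thesis using \<open>1 \<le> ln (real r)\<close> by (simp add: real_sqrt_divide)
  qed
  then have "sqrt M / 432\<^sup>2 * ln s * sqrt (ln r / ln (ln r)) \<le> sqrt M / 432\<^sup>2 * ln s * (ln r / sqrt M)"
    using M \<open>s \<ge> 1\<close> by (intro mult_left_mono) auto
  also have "\<dots> = ln s * ln r / 432\<^sup>2"
    using M by simp
  also have "\<dots> \<le> torus_L1_norm (exp_sum A)"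
    by (rule torus_L1_norm_exp_sum_rows_ge [OF \<open>finite A\<close> rows \<open>s \<ge> 1\<close>]) (use \<open>r \<ge> 3\<close> in simp)
  finally show "sqrt M / 432\<^sup>2 * ln s * sqrt (ln r / ln (ln r)) \<le> torus_L1_norm (exp_sum A)" .
qed

end
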